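(* Let $P=(p(k,i;l,j))_{(k,i),(l,j)\in\mathbb F}$ be an irreducible, positive recurrent stochastic matrix that is block-monotone with block size $d$ (i.e. $P\in\mathsf{BM}_d$), with unique stationary probability vector $\pi$. Suppose that there exist a real column vector $v=(v(k,i))_{(k,i)\in\mathbb F}$ with $v(k,i)\ge 1$ and $v(k,i)\le v(k+1,i)$ for all $(k,i)\in\mathbb F$, and constants $\gamma\in(0,1)$ and $b\in(0,\infty)$, such that $$Pv\le \gamma v+b\,\mathbf 1_0 .$$ Then for all $n\in\mathbb N$ and all $m\in\mathbb N$, $$\left\|{}_{(n)}\pi_n-\pi\right\|\le 4\gamma^m\frac{b}{1-\gamma}+2m\sum_{i\in\mathbb D}{}_{(n)}\pi_n(n,i),$$ and $$\left\|{}_{(n)}\pi_n-\pi\right\|\le \frac{b}{1-\gamma}\left(4\gamma^m+2m\sum_{i\in\mathbb D}\frac{1}{v(n,i)}\right).$$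
   Context: Notation: $\mathbb N=\{1,2,\dots\}$, $\mathbb Z_+=\{0,1,2,\dots\}$, $d\in\mathbb N$, $\mathbb D=\{1,\dots,d\}$, $\mathbb F=\mathbb Z_+\times\mathbb D$. Vector and matrix inequalities are entrywise. A stochastic matrix $P=(p(k,i;l,j))_{(k,i),(l,j)\in\mathbb F}$ is block-monotone with block size $d$ (written $P\in\mathsf{BM}_d$) if $\sum_{m\ge l}p(k,i;m,j)\le\sum_{m\ge l}p(k+1,i;m,j)$ for all $k,l\in\mathbb Z_+$ and $i,j\in\mathbb D$. $\mathbf 1_0$ is the column vector indexed by $\mathbb F$ whose $(k,i)$ entry is $1$ if $k=0$ and $0$ if $k\ge1$. For $n\in\mathbb N$, the last-column-block-augmented truncation ${}_{(n)}P_n=({}_{(n)}p_n(k,i;l,j))_{(k,i),(l,j)\in\mathbb F}$ of $P$ is the stochastic matrix with ${}_{(n)}p_n(k,i;l,j)=p(k,i;l,j)$ for $l\le n-1$, ${}_{(n)}p_n(k,i;n,j)=\sum_{m\ge n}p(k,i;m,j)$, and ${}_{(n)}p_n(k,i;l,j)=0$ for $l>n$ (for all $k\in\mathbb Z_+$, $i,j\in\mathbb D$). ${}_{(n)}\pi_n=({}_{(n)}\pi_n(k,i))_{(k,i)\in\mathbb F}$ denotes a stationary probability vector of ${}_{(n)}P_n$ (it vanishes at $(k,i)$ with $k>n$). $\|x\|=\sum_{(k,i)\in\mathbb F}|x(k,i)|$ for a row vector $x$. *)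

theory Defs
  imports "HOL-Analysis.Analysis"
begin

text \<open>
  The phase set is a finite type \<open>'d\<close>, of arbitrary size \<open>d = CARD('d) \<ge> 1\<close>, and the index set
  \<open>\<nat>\<^sub>0 \<times> {1..d}\<close> (level, phase) is the type \<open>nat \<times> 'd\<close>. Countable matrices and vectors are
  real-valued functions. The general notions are stated over an arbitrary index type \<open>'s\<close>.
\<close>

definition stochastic :: "('s \<Rightarrow> 's \<Rightarrow> real) \<Rightarrow> bool" where
  "stochastic P \<longleftrightarrow> (\<forall>x y. 0 \<le> P x y) \<and> (\<forall>x. (P x has_sum 1) UNIV)"

primrec mat_power :: "('s \<Rightarrow> 's \<Rightarrow> real) \<Rightarrow> nat \<Rightarrow> 's \<Rightarrow> 's \<Rightarrow> real" where
  "mat_power P 0 x y = (if x = y then 1 else 0)"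
| "mat_power P (Suc t) x y = (\<Sum>\<^sub>\<infinity>z. P x z * mat_power P t z y)"

definition irreducible_matrix :: "('s \<Rightarrow> 's \<Rightarrow> real) \<Rightarrow> bool" where
  "irreducible_matrix P \<longleftrightarrow> (\<forall>x y. \<exists>t. mat_power P t x y > 0)"

text \<open>
  \<open>first_passage P t x y\<close> is the probability that the chain started in \<open>x\<close> visits \<open>y\<close> at time
  \<open>t \<ge> 1\<close> and at none of the times \<open>1, \<dots>, t - 1\<close>. For \<open>x = y\<close> this is the distribution of the
  return time.
\<close>

fun first_passage :: "('s \<Rightarrow> 's \<Rightarrow> real) \<Rightarrow> nat \<Rightarrow> 's \<Rightarrow> 's \<Rightarrow> real" where
  "first_passage P 0 x y = 0"
| "first_passage P (Suc 0) x y = P x y"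
| "first_passage P (Suc (Suc t)) x y =
     (\<Sum>\<^sub>\<infinity>z\<in>-{y}. P x z * first_passage P (Suc t) z y)"

text \<open>Every state is returned to with probability one, and the mean return time is finite.\<close>

definition positive_recurrent :: "('s \<Rightarrow> 's \<Rightarrow> real) \<Rightarrow> bool" where
  "positive_recurrent P \<longleftrightarrow>
     (\<forall>x. (\<lambda>t. first_passage P t x x) sums 1 \<and>
          summable (\<lambda>t. real t * first_passage P t x x))"

definition stationary_probability :: "('s \<Rightarrow> 's \<Rightarrow> real) \<Rightarrow> ('s \<Rightarrow> real) \<Rightarrow> bool" where
  "stationary_probability P p \<longleftrightarrow>
     (\<forall>x. 0 \<le> p x) \<and> (p has_sum 1) UNIV \<and>
     (\<forall>y. ((\<lambda>x. p x * P x y) has_sum p y) UNIV)"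

definition row_norm :: "('s \<Rightarrow> real) \<Rightarrow> real" where
  "row_norm x = (\<Sum>\<^sub>\<infinity>s. \<bar>x s\<bar>)"

definition block_monotone :: "(nat \<times> 'd::finite \<Rightarrow> nat \<times> 'd \<Rightarrow> real) \<Rightarrow> bool" where
  "block_monotone P \<longleftrightarrow> stochastic P \<and>
     (\<forall>k l i j. (\<Sum>\<^sub>\<infinity>m\<in>{l..}. P (k, i) (m, j)) \<le> (\<Sum>\<^sub>\<infinity>m\<in>{l..}. P (k + 1, i) (m, j)))"

definition one_level0 :: "nat \<times> 'd::finite \<Rightarrow> real" where
  "one_level0 x = (if fst x = 0 then 1 else 0)"

definition last_column_truncation ::
  "nat \<Rightarrow> (nat \<times> 'd::finite \<Rightarrow> nat \<times> 'd \<Rightarrow> real) \<Rightarrow> nat \<times> 'd \<Rightarrow> nat \<times> 'd \<Rightarrow> real" where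
  "last_column_truncation n P x y =
     (if fst y < n then P x y
      else if fst y = n then (\<Sum>\<^sub>\<infinity>m\<in>{n..}. P x (m, snd y))
      else 0)"

text \<open>
  The inequality \<open>P v \<le> \<gamma> v + b 1\<^sub>0\<close>. Finiteness of \<open>P v\<close> is part of the condition and has to be
  said explicitly, because \<open>infsum\<close> is \<open>0\<close> for families that are not summable.
\<close>

definition geometric_drift ::
  "(nat \<times> 'd::finite \<Rightarrow> nat \<times> 'd \<Rightarrow> real) \<Rightarrow> (nat \<times> 'd \<Rightarrow> real) \<Rightarrow> real \<Rightarrow> real \<Rightarrow> bool" where
  "geometric_drift P v \<gamma> b \<longleftrightarrow>
     (\<forall>x. (\<lambda>y. P x y * v y) summable_on UNIV \<and>
          (\<Sum>\<^sub>\<infinity>y. P x y * v y) \<le> \<gamma> * v x + b * one_level0 x)"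

end

theory Submission
  imports Defs
begin

text \<open>
  Block-monotonicity makes the phase process autonomous, so \<open>\<pi>\<close> and \<open>\<pi>\<^sub>n\<close> have the same phase
  marginal; let \<open>\<delta>\<close> carry that marginal on level \<open>0\<close>. Then \<open>\<delta>\<close> is stochastically below both \<open>\<pi>\<close>
  and \<open>\<pi>\<^sub>n\<close>, and the distance is split at \<open>\<delta> P\<^sup>m\<close> and its analogue for the truncation. Two
  stochastically ordered row vectors contract at rate \<open>\<gamma>\<close>, because the mass that the larger one puts
  on level \<open>0\<close> cancels at every step; this takes the place of the usual monotone coupling. The two
  evolutions of \<open>\<delta>\<close> drift apart by at most twice the stationary mass of level \<open>n\<close> per step.
\<close>

section \<open>Row vectors and stochastic matrices\<close>

text \<open>Nonnegativity turns summability of the row sums into joint summability; exchanging the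
  coordinates then allows summation by columns.\<close>

lemma tonelli_has_sum:
  fixes f :: "'s \<Rightarrow> 't \<Rightarrow> real"
  assumes nonneg: "\<And>x y. 0 \<le> f x y"
    and inner: "\<And>x. (f x has_sum g x) UNIV"
    and outer: "(g has_sum S) UNIV"
  shows "((\<lambda>y. \<Sum>\<^sub>\<infinity>x. f x y) has_sum S) UNIV"
proof -
  have "(\<lambda>(x, y). f x y) summable_on UNIV \<times> UNIV"
    by (rule summable_on_SigmaI[where g = g])
      (use assms in \<open>auto simp: has_sum_imp_summable\<close>)
  then have "((\<lambda>(x, y). f x y) has_sum S) (UNIV \<times> UNIV)"
    by (rule has_sum_SigmaI[rotated 2]) (use inner outer in auto)
  then have swapped: "((\<lambda>(y, x). f x y) has_sum S) (UNIV \<times> UNIV)"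
    by (subst has_sum_swap) simp
  then have summable: "(\<lambda>x. f x y) summable_on UNIV" for y
    using summable_on_SigmaD1[OF has_sum_imp_summable[OF swapped], of y] nonneg by simp
  show "((\<lambda>y. \<Sum>\<^sub>\<infinity>x. f x y) has_sum S) UNIV"
    by (rule has_sum_SigmaD[OF swapped]) (use summable in auto)
qed

text \<open>A finite measure given by its point masses. The total mass is left free, because
  cancelling common mass produces row vectors of mass below one.\<close>

definition nonneg_summable :: "('s \<Rightarrow> real) \<Rightarrow> bool" where
  "nonneg_summable \<mu> \<longleftrightarrow> (\<forall>x. 0 \<le> \<mu> x) \<and> \<mu> summable_on UNIV"

lemma nonneg_summableD: "nonneg_summable \<mu> \<Longrightarrow> 0 \<le> \<mu> x"
  by (simp add: nonneg_summable_def)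

text \<open>The row vector \<mu>P. The matrix comes first so that \<open>row_mult P ^^ t\<close> is
  multiplication by the t-th power of P from the right.\<close>

definition row_mult :: "('s \<Rightarrow> 's \<Rightarrow> real) \<Rightarrow> ('s \<Rightarrow> real) \<Rightarrow> 's \<Rightarrow> real" where
  "row_mult P \<mu> y = (\<Sum>\<^sub>\<infinity>x. \<mu> x * P x y)"

lemma stochastic_nonneg: "stochastic P \<Longrightarrow> 0 \<le> P x y"
  by (simp add: stochastic_def)

lemma stochastic_has_sum: "stochastic P \<Longrightarrow> (P x has_sum 1) UNIV"
  by (simp add: stochastic_def)

lemma stochastic_nonneg_summable: "stochastic P \<Longrightarrow> nonneg_summable (P x)"
  by (meson has_sum_imp_summable nonneg_summable_def stochastic_def)

lemma nonneg_summable_mult_bounded: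
  assumes "nonneg_summable \<mu>" "\<And>x. 0 \<le> f x" "\<And>x. f x \<le> (C::real)"
  shows "(\<lambda>x. \<mu> x * f x) summable_on UNIV"
  by (rule summable_on_comparison_test[where f = "\<lambda>x. \<mu> x * C"])
    (use assms in \<open>auto simp: nonneg_summable_def intro!: summable_on_cmult_left mult_left_mono\<close>)

text \<open>Associativity (\<mu>P)f = \<mu>(Pf) by Tonelli. Here f may be unbounded, so finiteness
  of Pf and of \<mu>(Pf) has to be assumed.\<close>

lemma row_mult_pairing:
  assumes "stochastic P" "nonneg_summable \<mu>" "\<And>y. 0 \<le> f y"
    and "\<And>x. (\<lambda>y. P x y * f y) summable_on UNIV"
    and "(\<lambda>x. \<mu> x * (\<Sum>\<^sub>\<infinity>y. P x y * f y)) summable_on UNIV"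
  shows "(\<lambda>y. row_mult P \<mu> y * f y) summable_on UNIV"
    and "(\<Sum>\<^sub>\<infinity>y. row_mult P \<mu> y * f y) = (\<Sum>\<^sub>\<infinity>x. \<mu> x * (\<Sum>\<^sub>\<infinity>y. P x y * f y))"
proof -
  have "((\<lambda>y. \<Sum>\<^sub>\<infinity>x. \<mu> x * (P x y * f y)) has_sum
      (\<Sum>\<^sub>\<infinity>x. \<mu> x * (\<Sum>\<^sub>\<infinity>y. P x y * f y))) UNIV"
    by (rule tonelli_has_sum[where g = "\<lambda>x. \<mu> x * (\<Sum>\<^sub>\<infinity>y. P x y * f y)"])
      (use assms in \<open>auto simp: nonneg_summable_def stochastic_nonneg intro!: has_sum_cmult_right\<close>)
  moreover have "(\<Sum>\<^sub>\<infinity>x. \<mu> x * (P x y * f y)) = row_mult P \<mu> y * f y" for y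
    unfolding row_mult_def by (simp flip: mult.assoc add: infsum_cmult_left')
  ultimately have "((\<lambda>y. row_mult P \<mu> y * f y) has_sum
      (\<Sum>\<^sub>\<infinity>x. \<mu> x * (\<Sum>\<^sub>\<infinity>y. P x y * f y))) UNIV" by simp
  then show "(\<lambda>y. row_mult P \<mu> y * f y) summable_on UNIV"
    and "(\<Sum>\<^sub>\<infinity>y. row_mult P \<mu> y * f y) = (\<Sum>\<^sub>\<infinity>x. \<mu> x * (\<Sum>\<^sub>\<infinity>y. P x y * f y))"
    by (auto simp: has_sum_iff)
qed

lemma stochastic_le_1: 
  assumes "stochastic P" shows "P x y \<le> 1"
  using finite_sum_le_has_sum[OF stochastic_has_sum[OF assms], of "{y}" x] stochastic_nonneg[OF assms]
  by auto

lemma stochastic_pairing_bounded: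
  assumes "stochastic P" "\<And>x. 0 \<le> f x" "\<And>x. f x \<le> C"
  shows "0 \<le> (\<Sum>\<^sub>\<infinity>y. P x y * f y)" "(\<Sum>\<^sub>\<infinity>y. P x y * f y) \<le> C"
proof -
  show "0 \<le> (\<Sum>\<^sub>\<infinity>y. P x y * f y)"
    using assms by (intro infsum_nonneg) (auto simp: stochastic_nonneg)
  have "((\<lambda>y. P x y * C) has_sum 1 * C) UNIV"
    by (rule has_sum_cmult_left) (rule stochastic_has_sum[OF assms(1)])
  moreover have "(\<lambda>y. P x y * f y) summable_on UNIV"
    using assms by (intro nonneg_summable_mult_bounded stochastic_nonneg_summable)
  ultimately have "(\<Sum>\<^sub>\<infinity>y. P x y * f y) \<le> 1 * C"
    by (intro has_sum_mono[OF has_sum_infsum]) (use assms in \<open>auto simp: stochastic_nonneg mult_left_mono\<close>)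
  then show "(\<Sum>\<^sub>\<infinity>y. P x y * f y) \<le> C" by simp
qed

lemma row_mult_pairing_bounded:
  assumes "stochastic P" "nonneg_summable \<mu>" "\<And>y. 0 \<le> f y" "\<And>y. f y \<le> C"
  shows "(\<Sum>\<^sub>\<infinity>y. row_mult P \<mu> y * f y) = (\<Sum>\<^sub>\<infinity>x. \<mu> x * (\<Sum>\<^sub>\<infinity>y. P x y * f y))"
proof (rule row_mult_pairing(2)[OF assms(1-3)])
  show "(\<lambda>y. P x y * f y) summable_on UNIV" for x
    using assms by (intro nonneg_summable_mult_bounded[OF stochastic_nonneg_summable])
  show "(\<lambda>x. \<mu> x * (\<Sum>\<^sub>\<infinity>y. P x y * f y)) summable_on UNIV"
    by (rule nonneg_summable_mult_bounded[OF assms(2)])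
      (rule stochastic_pairing_bounded[OF assms(1,3,4)])+
qed

lemma nonneg_summable_row_mult:
  assumes "stochastic P" "nonneg_summable \<mu>"
  shows "nonneg_summable (row_mult P \<mu>)"
proof -
  have "(\<lambda>y. row_mult P \<mu> y * 1) summable_on UNIV"
    by (rule row_mult_pairing(1))
      (use assms in \<open>simp_all add: infsumI[OF stochastic_has_sum] has_sum_imp_summable[OF stochastic_has_sum]
        nonneg_summable_def\<close>)
  moreover have "0 \<le> row_mult P \<mu> y" for y
    unfolding row_mult_def using assms
    by (intro infsum_nonneg) (auto simp: stochastic_nonneg nonneg_summable_def)
  ultimately show ?thesis by (simp add: nonneg_summable_def)
qed

lemma row_mult_diff:
  assumes "stochastic P" "nonneg_summable \<sigma>" "nonneg_summable \<tau>"
  shows "row_mult P (\<lambda>x. \<sigma> x - \<tau> x) = (\<lambda>y. row_mult P \<sigma> y - row_mult P \<tau> y)"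
proof
  fix y
  have s: "(\<lambda>x. \<mu> x * P x y) summable_on UNIV" if "nonneg_summable \<mu>" for \<mu>
    by (rule nonneg_summable_mult_bounded[where C = 1])
      (use assms that in \<open>auto simp: stochastic_nonneg stochastic_le_1\<close>)
  have "((\<lambda>x. \<sigma> x * P x y + - (\<tau> x * P x y)) has_sum row_mult P \<sigma> y + - row_mult P \<tau> y) UNIV"
    unfolding row_mult_def using s assms by (intro has_sum_add has_sum_uminusI has_sum_infsum) auto
  then show "row_mult P (\<lambda>x. \<sigma> x - \<tau> x) y = row_mult P \<sigma> y - row_mult P \<tau> y"
    unfolding row_mult_def[of P "\<lambda>x. _ x - _ x"] by (intro infsumI) (simp add: algebra_simps)
qed

section \<open>The norm of row vectors\<close>

lemma row_norm_triangle:
  assumes "(\<lambda>x. \<bar>f x\<bar>) summable_on UNIV" "(\<lambda>x. \<bar>g x\<bar>) summable_on UNIV"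
  shows "row_norm (\<lambda>x. f x + g x) \<le> row_norm f + row_norm g"
    and "(\<lambda>x. \<bar>f x + g x\<bar>) summable_on UNIV"
proof -
  have sum: "(\<lambda>x. \<bar>f x\<bar> + \<bar>g x\<bar>) summable_on UNIV"
    using assms by (auto intro!: summable_on_add)
  show s: "(\<lambda>x. \<bar>f x + g x\<bar>) summable_on UNIV"
    by (rule summable_on_comparison_test[OF sum]) auto
  have "row_norm (\<lambda>x. f x + g x) \<le> (\<Sum>\<^sub>\<infinity>x. \<bar>f x\<bar> + \<bar>g x\<bar>)"
    unfolding row_norm_def using s sum by (intro infsum_mono) auto
  also have "\<dots> = row_norm f + row_norm g"
    unfolding row_norm_def using assms by (intro infsum_add) auto
  finally show "row_norm (\<lambda>x. f x + g x) \<le> row_norm f + row_norm g" .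
qed

lemma nonneg_summable_diff:
  assumes "nonneg_summable \<sigma>" "nonneg_summable \<tau>"
  shows "(\<lambda>x. \<bar>\<sigma> x - \<tau> x\<bar>) summable_on UNIV"
    and "row_norm (\<lambda>x. \<sigma> x - \<tau> x) \<le> infsum \<sigma> UNIV + infsum \<tau> UNIV"
  using row_norm_triangle[of \<sigma> "\<lambda>x. - \<tau> x"] assms
  by (simp_all add: nonneg_summable_def row_norm_def)

lemma row_norm_diff_triangle:
  assumes "nonneg_summable f" "nonneg_summable g" "nonneg_summable h"
  shows "row_norm (\<lambda>x. f x - h x) \<le> row_norm (\<lambda>x. f x - g x) + row_norm (\<lambda>x. g x - h x)"
  using row_norm_triangle(1)[OF nonneg_summable_diff(1)[OF assms(1,2)] nonneg_summable_diff(1)[OF assms(2,3)]]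
  by simp

text \<open>Entrywise, the absolute value of \<rho>P is at most the product of the absolute value of
  \<rho> with P, and a stochastic P preserves the total mass of the latter.\<close>

lemma row_norm_row_mult_le:
  assumes P: "stochastic P" and "(\<lambda>x. \<bar>\<rho> x\<bar>) summable_on UNIV"
  shows "row_norm (row_mult P \<rho>) \<le> row_norm \<rho>"
proof -
  define \<mu> where "\<mu> = (\<lambda>x. \<bar>\<rho> x\<bar>)"
  have \<mu>: "nonneg_summable \<mu>" using assms by (auto simp: nonneg_summable_def \<mu>_def)
  have s: "(\<lambda>x. \<mu> x * P x y) summable_on UNIV" for y
    by (rule nonneg_summable_mult_bounded[where C = 1])
      (use assms \<mu> in \<open>auto simp: stochastic_nonneg stochastic_le_1\<close>)
  have le: "\<bar>row_mult P \<rho> y\<bar> \<le> row_mult P \<mu> y" for y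
    using norm_infsum_bound[of "\<lambda>x. \<rho> x * P x y" UNIV] s[of y] P
    by (simp add: row_mult_def \<mu>_def abs_mult stochastic_nonneg)
  note r = nonneg_summable_row_mult[OF P \<mu>]
  have "(\<lambda>y. \<bar>row_mult P \<rho> y\<bar>) summable_on UNIV"
    by (rule summable_on_comparison_test[where f = "row_mult P \<mu>"])
      (use r le in \<open>auto simp: nonneg_summable_def\<close>)
  then have "row_norm (row_mult P \<rho>) \<le> infsum (row_mult P \<mu>) UNIV"
    unfolding row_norm_def using r le by (intro infsum_mono) (auto simp: nonneg_summable_def)
  also have "\<dots> = row_norm \<rho>"
    using row_mult_pairing_bounded[OF P \<mu>, of "\<lambda>_. 1" 1] infsumI[OF stochastic_has_sum[OF P]]
    by (simp add: row_norm_def \<mu>_def)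
  finally show ?thesis .
qed

lemma row_mult_stationary:
  assumes "stationary_probability P p"
  shows "row_mult P p = p" "nonneg_summable p" "infsum p UNIV = 1"
  using assms by (auto simp: stationary_probability_def row_mult_def nonneg_summable_def fun_eq_iff
    has_sum_iff)

lemma funpow_row_mult:
  assumes "stochastic P" "nonneg_summable \<mu>"
  shows "nonneg_summable ((row_mult P ^^ t) \<mu>)"
  by (induction t) (use assms in \<open>auto intro: nonneg_summable_row_mult\<close>)

lemma funpow_row_mult_diff:
  assumes "stochastic P" "nonneg_summable \<sigma>" "nonneg_summable \<tau>"
  shows "(row_mult P ^^ t) (\<lambda>x. \<sigma> x - \<tau> x) = (\<lambda>x. (row_mult P ^^ t) \<sigma> x - (row_mult P ^^ t) \<tau> x)"
  by (induction t) (use assms in \<open>auto simp: row_mult_diff funpow_row_mult\<close>)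

section \<open>Tails and stochastic order\<close>

text \<open>Tails are kept separately for each phase j; \<open>tail \<mu> 0 j\<close> is the phase
  marginal of \<mu>.\<close>

definition tail :: "(nat \<times> 'd \<Rightarrow> real) \<Rightarrow> nat \<Rightarrow> 'd \<Rightarrow> real" where
  "tail \<mu> l j = (\<Sum>\<^sub>\<infinity>m\<in>{l..}. \<mu> (m, j))"

text \<open>The indicator function behind a tail. Writing tails as pairings with it lets them
  inherit associativity and bounds from bounded functions.\<close>

definition at_least :: "nat \<Rightarrow> 'd \<Rightarrow> nat \<times> 'd \<Rightarrow> real" where
  "at_least l j y = of_bool (l \<le> fst y \<and> snd y = j)"

lemma at_least_nonneg: "0 \<le> at_least l j y"
  and at_least_le_1: "at_least l j y \<le> 1"
  by (simp_all add: at_least_def)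

lemma tail_eq_pairing: "tail \<mu> l j = (\<Sum>\<^sub>\<infinity>y. \<mu> y * at_least l j y)"
proof -
  have "tail \<mu> l j = infsum \<mu> ((\<lambda>m. (m, j)) ` {l..})"
    unfolding tail_def by (subst infsum_reindex) (auto simp: inj_on_def o_def)
  also have "\<dots> = (\<Sum>\<^sub>\<infinity>y. \<mu> y * at_least l j y)"
    by (rule infsum_cong_neutral) (auto simp: at_least_def)
  finally show ?thesis .
qed

lemma tail_nonneg: "nonneg_summable \<mu> \<Longrightarrow> 0 \<le> tail \<mu> l j"
  by (auto simp: tail_def nonneg_summable_def intro: infsum_nonneg)

lemma summable_on_phase:
  fixes f :: "nat \<times> 'd \<Rightarrow> real"
  assumes "f summable_on UNIV"
  shows "(\<lambda>m. f (m, j)) summable_on A"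
proof -
  have "f summable_on (\<lambda>m. (m, j)) ` A"
    by (rule summable_on_subset[OF assms]) auto
  then show ?thesis
    by (subst (asm) summable_on_reindex) (auto simp: inj_on_def o_def)
qed

lemma tail_Suc:
  assumes "\<mu> summable_on UNIV"
  shows "tail \<mu> l j = \<mu> (l, j) + tail \<mu> (Suc l) j"
proof -
  have "{l..} = insert l {Suc l..}" by auto
  then show ?thesis
    unfolding tail_def using summable_on_phase[OF assms] by (simp add: infsum_insert)
qed

lemma infsum_eq_sum_tail:
  fixes f :: "nat \<times> 'd::finite \<Rightarrow> real"
  assumes "f summable_on UNIV"
  shows "infsum f UNIV = (\<Sum>j\<in>UNIV. tail f 0 j)"
proof -
  have "(f has_sum infsum f UNIV) (UNIV \<times> UNIV)"
    using assms by simp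
  then have "((\<lambda>(j, k). f (k, j)) has_sum infsum f UNIV) (UNIV \<times> UNIV)"
    by (subst (asm) has_sum_swap)
  then have "((\<lambda>j. tail f 0 j) has_sum infsum f UNIV) UNIV"
    by (rule has_sum_SigmaD) (use summable_on_phase[OF assms] in \<open>auto simp: tail_def atLeast_0\<close>)
  then show ?thesis by (simp add: has_sum_finite_iff)
qed

lemma tail_row_mult:
  assumes "stochastic P" "nonneg_summable \<mu>"
  shows "tail (row_mult P \<mu>) l j = (\<Sum>\<^sub>\<infinity>x. \<mu> x * tail (P x) l j)"
  unfolding tail_eq_pairing
  by (rule row_mult_pairing_bounded[OF assms at_least_nonneg at_least_le_1])

lemma tail_stochastic:
  assumes "stochastic P"
  shows "0 \<le> tail (P x) l j" "tail (P x) l j \<le> 1"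
  unfolding tail_eq_pairing
  by (rule stochastic_pairing_bounded[OF assms at_least_nonneg at_least_le_1])+

text \<open>Blockwise stochastic order, with the larger vector first. Equality of the tails at level
  0 means equal phase marginals, hence equal total mass.\<close>

definition dominates :: "(nat \<times> 'd \<Rightarrow> real) \<Rightarrow> (nat \<times> 'd \<Rightarrow> real) \<Rightarrow> bool" where
  "dominates \<sigma> \<tau> \<longleftrightarrow> nonneg_summable \<sigma> \<and> nonneg_summable \<tau> \<and>
     (\<forall>l j. tail \<tau> l j \<le> tail \<sigma> l j) \<and> (\<forall>j. tail \<tau> 0 j = tail \<sigma> 0 j)"

lemma dominates_infsum_eq:
  fixes \<sigma> \<tau> :: "nat \<times> 'd::finite \<Rightarrow> real"
  shows "dominates \<sigma> \<tau> \<Longrightarrow> infsum \<tau> UNIV = infsum \<sigma> UNIV"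
  by (simp add: dominates_def nonneg_summable_def infsum_eq_sum_tail)

text \<open>The discrete derivative in the level at fixed phase, with F read as 0 below level 0.
  These are the coefficients that express F through the indicators \<open>at_least\<close>.\<close>

definition level_increment :: "(nat \<times> 'd \<Rightarrow> real) \<Rightarrow> nat \<times> 'd \<Rightarrow> real" where
  "level_increment F s = (if fst s = 0 then F s else F s - F (fst s - 1, snd s))"

text \<open>At (k, i) only the indicators of phase i and of levels up to k are nonzero, so the sum
  is finite and telescopes.\<close>

lemma level_increment_has_sum:
  "((\<lambda>s. level_increment F s * at_least (fst s) (snd s) (k, i)) has_sum F (k, i)) UNIV"
proof (rule has_sum_finite_neutralI[where B = "(\<lambda>m. (m, i)) ` {..k}"])
  have "(\<Sum>m\<le>k. level_increment F (m, i)) = F (k, i)"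
    by (induction k) (auto simp: level_increment_def)
  then show "F (k, i) = (\<Sum>s\<in>(\<lambda>m. (m, i)) ` {..k}.
      level_increment F s * at_least (fst s) (snd s) (k, i))"
    by (subst sum.reindex) (auto simp: inj_on_def at_least_def)
qed (auto simp: at_least_def)

lemma level_increment_nonneg:
  assumes "\<And>x. 0 \<le> F x" "\<And>k i. F (k, i) \<le> F (Suc k, i)"
  shows "0 \<le> level_increment F s"
  using assms(1)[of s] assms(2)[of "fst s - 1" "snd s"] by (cases s) (auto simp: level_increment_def)

text \<open>Summation by parts: F is expanded into tail indicators and the order of summation is
  exchanged. Monotonicity of F makes the increments nonnegative, as Tonelli requires.\<close>

lemma pairing_eq_tails:
  fixes F :: "nat \<times> 'd \<Rightarrow> real"
  assumes \<mu>: "nonneg_summable \<mu>" and F: "\<And>x. 0 \<le> F x" "\<And>k i. F (k, i) \<le> F (Suc k, i)"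
    and sum: "(\<lambda>x. \<mu> x * F x) summable_on UNIV"
  shows "((\<lambda>s. level_increment F s * tail \<mu> (fst s) (snd s)) has_sum (\<Sum>\<^sub>\<infinity>x. \<mu> x * F x)) UNIV"
proof -
  have "((\<lambda>s. \<Sum>\<^sub>\<infinity>x. \<mu> x * (level_increment F s * at_least (fst s) (snd s) x))
      has_sum (\<Sum>\<^sub>\<infinity>x. \<mu> x * F x)) UNIV"
  proof (rule tonelli_has_sum[where g = "\<lambda>x. \<mu> x * F x"])
    show "0 \<le> \<mu> x * (level_increment F s * at_least (fst s) (snd s) x)" for x s
      by (intro mult_nonneg_nonneg nonneg_summableD[OF \<mu>] at_least_nonneg level_increment_nonneg[OF F])
    show "((\<lambda>s. \<mu> x * (level_increment F s * at_least (fst s) (snd s) x)) has_sum \<mu> x * F x) UNIV" for x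
      using level_increment_has_sum[of F "fst x" "snd x"] by (intro has_sum_cmult_right) simp
  qed (use sum in auto)
  then show ?thesis
    by (simp add: tail_eq_pairing mult.left_commute[of "\<mu> _"] infsum_cmult_right')
qed

lemma dominates_pairing_mono:
  assumes "dominates \<sigma> \<tau>" and F: "\<And>x. 0 \<le> F x" "\<And>k i. F (k, i) \<le> F (Suc k, i)"
    and sum: "(\<lambda>x. \<sigma> x * F x) summable_on UNIV" "(\<lambda>x. \<tau> x * F x) summable_on UNIV"
  shows "(\<Sum>\<^sub>\<infinity>x. \<tau> x * F x) \<le> (\<Sum>\<^sub>\<infinity>x. \<sigma> x * F x)"
proof (rule has_sum_mono)
  show "level_increment F s * tail \<tau> (fst s) (snd s) \<le> level_increment F s * tail \<sigma> (fst s) (snd s)" for s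
    using assms(1) by (intro mult_left_mono level_increment_nonneg[OF F]) (simp add: dominates_def)
qed (rule pairing_eq_tails[OF _ F sum(2)] pairing_eq_tails[OF _ F sum(1)],
    use assms(1) in \<open>simp add: dominates_def\<close>)+

section \<open>Consequences of block-monotonicity\<close>

lemma block_monotoneD:
  assumes "block_monotone P"
  shows "stochastic P" "tail (P (k, i)) l j \<le> tail (P (Suc k, i)) l j"
  using assms by (auto simp: block_monotone_def tail_def)

text \<open>Block-monotonicity at l = 0 makes each entry nondecreasing in k, while the sum over j is
  1 for every k. Hence no entry can increase, and the law of the next phase depends on the current
  phase alone.\<close>

lemma phase_kernel_const:
  fixes P :: "nat \<times> 'd::finite \<Rightarrow> nat \<times> 'd \<Rightarrow> real"
  assumes "block_monotone P"
  shows "tail (P (k, i)) 0 j = tail (P (0, i)) 0 j"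
proof (induction k)
  case (Suc k)
  have "(\<Sum>j\<in>UNIV. tail (P x) 0 j) = 1" for x
    using infsum_eq_sum_tail[of "P x"] stochastic_has_sum[OF block_monotoneD(1)[OF assms], of x]
    by (simp add: has_sum_iff)
  then have "(\<Sum>j\<in>UNIV. tail (P (Suc k, i)) 0 j - tail (P (k, i)) 0 j) = 0"
    by (simp add: sum_subtractf)
  then have "tail (P (Suc k, i)) 0 j - tail (P (k, i)) 0 j = 0"
    using block_monotoneD(2)[OF assms] by (subst (asm) sum_nonneg_eq_0_iff) auto
  with Suc show ?case by simp
qed simp

lemma phase_marginal_row_mult:
  fixes P :: "nat \<times> 'd::finite \<Rightarrow> nat \<times> 'd \<Rightarrow> real"
  assumes "block_monotone P" "nonneg_summable \<mu>"
  shows "tail (row_mult P \<mu>) 0 j = (\<Sum>i\<in>UNIV. tail \<mu> 0 i * tail (P (0, i)) 0 j)"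
proof -
  note P = block_monotoneD(1)[OF assms(1)]
  have phase: "tail (\<lambda>x. \<mu> x * tail (P x) 0 j) 0 i = tail \<mu> 0 i * tail (P (0, i)) 0 j" for i
  proof -
    have "tail (\<lambda>x. \<mu> x * tail (P x) 0 j) 0 i
        = (\<Sum>\<^sub>\<infinity>m\<in>{0..}. \<mu> (m, i) * tail (P (0, i)) 0 j)"
      unfolding tail_def[of "\<lambda>x. _ x * _ x"] by (subst phase_kernel_const[OF assms(1)]) (rule refl)
    then show ?thesis
      by (simp only: infsum_cmult_left' tail_def[of \<mu>])
  qed
  have "(\<lambda>x. \<mu> x * tail (P x) 0 j) summable_on UNIV"
    by (rule nonneg_summable_mult_bounded[OF assms(2) tail_stochastic[OF P]])
  then show ?thesis
    by (simp only: infsum_eq_sum_tail phase tail_row_mult[OF P assms(2)])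
qed

text \<open>A tail of \<mu>P pairs \<mu> with the tail of the row \<open>P x\<close>, which is
  nondecreasing in the level of x by block-monotonicity. Equal phase marginals stay equal because
  they evolve by the phase kernel alone.\<close>

lemma dominates_row_mult:
  fixes P :: "nat \<times> 'd::finite \<Rightarrow> nat \<times> 'd \<Rightarrow> real"
  assumes "block_monotone P" "dominates \<sigma> \<tau>"
  shows "dominates (row_mult P \<sigma>) (row_mult P \<tau>)"
proof -
  note P = block_monotoneD(1)[OF assms(1)]
  have \<sigma>: "nonneg_summable \<sigma>" and \<tau>: "nonneg_summable \<tau>" and eq: "\<And>j. tail \<tau> 0 j = tail \<sigma> 0 j"
    using assms(2) by (auto simp: dominates_def)
  have "tail (row_mult P \<tau>) l j \<le> tail (row_mult P \<sigma>) l j" for l j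
    unfolding tail_row_mult[OF P \<sigma>] tail_row_mult[OF P \<tau>]
    using assms(2) tail_stochastic[OF P] block_monotoneD(2)[OF assms(1)]
      nonneg_summable_mult_bounded[OF \<sigma> tail_stochastic[OF P]]
      nonneg_summable_mult_bounded[OF \<tau> tail_stochastic[OF P]]
    by (intro dominates_pairing_mono) auto
  then show ?thesis
    using \<sigma> \<tau> eq P phase_marginal_row_mult[OF assms(1)]
    by (simp add: dominates_def nonneg_summable_row_mult)
qed

lemma dominates_funpow_row_mult:
  fixes P :: "nat \<times> 'd::finite \<Rightarrow> nat \<times> 'd \<Rightarrow> real"
  assumes "block_monotone P" "dominates \<sigma> \<tau>"
  shows "dominates ((row_mult P ^^ t) \<sigma>) ((row_mult P ^^ t) \<tau>)"
  by (induction t) (use assms in \<open>auto intro: dominates_row_mult\<close>)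

section \<open>Geometric drift\<close>

lemma drift_nonneg:
  assumes "stochastic P" "\<And>x. 0 \<le> v x"
  shows "0 \<le> (\<Sum>\<^sub>\<infinity>y. P x y * v y)"
  using assms by (intro infsum_nonneg) (simp add: stochastic_nonneg)

lemma geometric_driftD:
  assumes "geometric_drift P v \<gamma> b"
  shows "(\<lambda>y. P x y * v y) summable_on UNIV"
    and "(\<Sum>\<^sub>\<infinity>y. P x y * v y) \<le> \<gamma> * v x + b * one_level0 x"
  using assms unfolding geometric_drift_def by blast+

text \<open>Without mass on level 0 the term with b never contributes, so only the factor \<gamma>
  remains.\<close>

lemma drift_row_mult:
  assumes P: "stochastic P" and drift: "geometric_drift P v \<gamma> b" and v: "\<And>x. 0 \<le> v x"
    and \<mu>: "nonneg_summable \<mu>" "\<And>x. fst x = 0 \<Longrightarrow> \<mu> x = 0"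
    and sum: "(\<lambda>x. \<mu> x * v x) summable_on UNIV"
  shows "(\<lambda>y. row_mult P \<mu> y * v y) summable_on UNIV"
    and "(\<Sum>\<^sub>\<infinity>y. row_mult P \<mu> y * v y) \<le> \<gamma> * (\<Sum>\<^sub>\<infinity>x. \<mu> x * v x)"
proof -
  define F where "F x = (\<Sum>\<^sub>\<infinity>y. P x y * v y)" for x
  have le: "\<mu> x * F x \<le> \<gamma> * (\<mu> x * v x)" for x
  proof (cases "fst x = 0")
    case False
    then have "F x \<le> \<gamma> * v x"
      using geometric_driftD(2)[OF drift, of x] by (simp add: F_def one_level0_def)
    then show ?thesis
      using mult_left_mono[of "F x" "\<gamma> * v x" "\<mu> x"] nonneg_summableD[OF \<mu>(1)]
      by (simp add: mult.left_commute)
  qed (simp add: \<mu>(2))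
  have s: "(\<lambda>x. \<mu> x * F x) summable_on UNIV"
    by (rule summable_on_comparison_test[OF summable_on_cmult_right[OF sum] le])
      (simp add: F_def drift_nonneg[OF P v] nonneg_summableD[OF \<mu>(1)])
  note pairing = row_mult_pairing[OF P \<mu>(1) v geometric_driftD(1)[OF drift], folded F_def, OF s]
  show "(\<lambda>y. row_mult P \<mu> y * v y) summable_on UNIV"
    by (rule pairing)
  show "(\<Sum>\<^sub>\<infinity>y. row_mult P \<mu> y * v y) \<le> \<gamma> * (\<Sum>\<^sub>\<infinity>x. \<mu> x * v x)"
    unfolding pairing(2) infsum_cmult_right'[symmetric]
    by (rule infsum_mono[OF s summable_on_cmult_right[OF sum] le])
qed

text \<open>The same vector, the level-0 part of \<sigma>, is subtracted from both sides. Tails from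
  level 1 on are untouched, and the two phase marginals drop by the same amount.\<close>

lemma dominates_remove_level0:
  assumes dom: "dominates \<sigma> \<tau>"
  defines "\<sigma>' \<equiv> \<lambda>x. if fst x = 0 then 0 else \<sigma> x"
    and "\<tau>' \<equiv> \<lambda>x. if fst x = 0 then \<tau> x - \<sigma> x else \<tau> x"
  shows "dominates \<sigma>' \<tau>'"
proof -
  have \<sigma>: "nonneg_summable \<sigma>" and \<tau>: "nonneg_summable \<tau>"
    using dom by (auto simp: dominates_def)
  then have sum: "\<sigma> summable_on UNIV" "\<tau> summable_on UNIV"
    by (auto simp: nonneg_summable_def)
  have \<sigma>': "nonneg_summable \<sigma>'"
    using nonneg_summableD[OF \<sigma>] summable_on_comparison_test[OF sum(1), of \<sigma>']
    by (auto simp: nonneg_summable_def \<sigma>'_def)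
  \<comment> \<open>With equal phase marginals, the vector with the smaller tail from level 1 has at
    least as much mass on level 0.\<close>
  have le: "\<sigma> (0, j) \<le> \<tau> (0, j)" for j
  proof -
    have "tail \<tau> 0 j = tail \<sigma> 0 j" "tail \<tau> 1 j \<le> tail \<sigma> 1 j"
      using dom by (auto simp: dominates_def)
    then show ?thesis
      using tail_Suc[OF sum(1), of 0 j] tail_Suc[OF sum(2), of 0 j] by simp
  qed
  have \<tau>'_le: "0 \<le> \<tau>' x" "\<tau>' x \<le> \<tau> x" for x
    using le[of "snd x"] nonneg_summableD[OF \<tau>, of x] nonneg_summableD[OF \<sigma>, of x]
    by (cases x; auto simp: \<tau>'_def)+
  then have \<tau>': "nonneg_summable \<tau>'"
    using summable_on_comparison_test[OF sum(2), of \<tau>'] by (auto simp: nonneg_summable_def)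
  have sum': "\<sigma>' summable_on UNIV" "\<tau>' summable_on UNIV"
    using \<sigma>' \<tau>' by (auto simp: nonneg_summable_def)
  have Suc: "tail \<sigma>' (Suc l) j = tail \<sigma> (Suc l) j" "tail \<tau>' (Suc l) j = tail \<tau> (Suc l) j" for l j
    by (auto simp: tail_def \<sigma>'_def \<tau>'_def intro!: infsum_cong)
  have zero: "tail \<tau>' 0 j = tail \<sigma>' 0 j" for j
  proof -
    have "tail \<tau> 0 j = tail \<sigma> 0 j" using dom by (auto simp: dominates_def)
    then show ?thesis
      using tail_Suc[OF sum(1), of 0 j] tail_Suc[OF sum(2), of 0 j]
        tail_Suc[OF sum'(1), of 0 j] tail_Suc[OF sum'(2), of 0 j]
      by (simp add: Suc) (simp add: \<sigma>'_def \<tau>'_def)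
  qed
  have "tail \<tau>' l j \<le> tail \<sigma>' l j" for l j
    using dom zero by (cases l) (auto simp: Suc dominates_def)
  with \<sigma>' \<tau>' zero show ?thesis by (simp add: dominates_def)
qed

text \<open>
  Each step first cancels the mass that the dominating row vector puts on level \<open>0\<close>: there the
  dominated one has at least as much, and off level \<open>0\<close> the drift is a contraction.
\<close>

lemma dominated_diff_contraction:
  fixes P :: "nat \<times> 'd::finite \<Rightarrow> nat \<times> 'd \<Rightarrow> real"
  assumes BM: "block_monotone P" and drift: "geometric_drift P v \<gamma> b"
    and v: "\<And>x. 1 \<le> v x" and \<gamma>: "0 \<le> \<gamma>"
    and "dominates \<sigma> \<tau>" "(\<lambda>x. \<sigma> x * v x) summable_on UNIV"
  shows "row_norm ((row_mult P ^^ t) (\<lambda>x. \<sigma> x - \<tau> x)) \<le> 2 * \<gamma> ^ t * (\<Sum>\<^sub>\<infinity>x. \<sigma> x * v x)"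
  using assms(5,6)
proof (induction t arbitrary: \<sigma> \<tau>)
  case 0
  \<comment> \<open>The factor 2 comes from here: the two masses are equal, and each is at most the
    v-sum of \<sigma> because v is at least 1.\<close>
  have "infsum \<sigma> UNIV \<le> (\<Sum>\<^sub>\<infinity>x. \<sigma> x * v x)"
    using 0 mult_left_mono[OF v] by (intro infsum_mono) (fastforce simp: dominates_def nonneg_summable_def)+
  then show ?case
    using nonneg_summable_diff(2)[of \<sigma> \<tau>] dominates_infsum_eq[OF 0(1)] 0(1)
    by (simp add: dominates_def)
next
  case (Suc t)
  define \<sigma>' where "\<sigma>' x = (if fst x = 0 then 0 else \<sigma> x)" for x
  define \<tau>' where "\<tau>' x = (if fst x = 0 then \<tau> x - \<sigma> x else \<tau> x)" for x
  note P = block_monotoneD(1)[OF BM]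
  have v0: "0 \<le> v x" for x using v[of x] by simp
  have dom: "dominates \<sigma>' \<tau>'"
    using dominates_remove_level0[OF Suc.prems(1)] by (simp add: \<sigma>'_def[abs_def] \<tau>'_def[abs_def])
  then have ns: "nonneg_summable \<sigma>'" "nonneg_summable \<tau>'" by (auto simp: dominates_def)
  have \<sigma>: "nonneg_summable \<sigma>" using Suc.prems(1) by (simp add: dominates_def)
  have le: "\<sigma>' x * v x \<le> \<sigma> x * v x" for x
    using v0 nonneg_summableD[OF \<sigma>] by (simp add: \<sigma>'_def)
  have sum: "(\<lambda>x. \<sigma>' x * v x) summable_on UNIV"
    by (rule summable_on_comparison_test[OF Suc.prems(2) le]) (simp add: v0 nonneg_summableD[OF ns(1)])
  note step = drift_row_mult[OF P drift v0 ns(1) _ sum]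
  have "(\<lambda>x. \<sigma> x - \<tau> x) = (\<lambda>x. \<sigma>' x - \<tau>' x)"
    by (auto simp: \<sigma>'_def \<tau>'_def)
  then have "(row_mult P ^^ Suc t) (\<lambda>x. \<sigma> x - \<tau> x) = (row_mult P ^^ t) (row_mult P (\<lambda>x. \<sigma>' x - \<tau>' x))"
    by (simp add: funpow_swap1)
  also have "\<dots> = (row_mult P ^^ t) (\<lambda>x. row_mult P \<sigma>' x - row_mult P \<tau>' x)"
    by (simp only: row_mult_diff[OF P ns])
  finally have "row_norm ((row_mult P ^^ Suc t) (\<lambda>x. \<sigma> x - \<tau> x))
      = row_norm ((row_mult P ^^ t) (\<lambda>x. row_mult P \<sigma>' x - row_mult P \<tau>' x))"
    by (rule arg_cong)
  \<comment> \<open>The induction hypothesis is used for the reduced pair after one multiplication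
    by P; that pair is still ordered, and the v-sum of its larger member is finite.\<close>
  also have "\<dots> \<le> 2 * \<gamma> ^ t * (\<Sum>\<^sub>\<infinity>x. row_mult P \<sigma>' x * v x)"
    by (intro Suc.IH dominates_row_mult BM dom step) (simp add: \<sigma>'_def)
  also have "\<dots> \<le> 2 * \<gamma> ^ t * (\<gamma> * (\<Sum>\<^sub>\<infinity>x. \<sigma>' x * v x))"
    using \<gamma> by (intro mult_left_mono step) (auto simp: \<sigma>'_def)
  also have "\<dots> \<le> 2 * \<gamma> ^ t * (\<gamma> * (\<Sum>\<^sub>\<infinity>x. \<sigma> x * v x))"
    using \<gamma> by (intro mult_left_mono infsum_mono sum Suc.prems(2) le) auto
  finally show ?case by (simp add: mult.assoc mult.left_commute)
qed

text \<open>
  Truncating \<open>v\<close> at \<open>K\<close> makes all sums finite; the truncation is invisible on a given finite set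
  once \<open>K\<close> is large.
\<close>

lemma stationary_drift_bound:
  assumes P: "stochastic P" and drift: "geometric_drift P v \<gamma> b" and v: "\<And>x. 0 \<le> v x"
    and \<gamma>: "0 \<le> \<gamma>" "\<gamma> < 1" and b: "0 \<le> b" and p: "stationary_probability P p"
  shows "(\<lambda>x. p x * v x) summable_on UNIV" "(\<Sum>\<^sub>\<infinity>x. p x * v x) \<le> b / (1 - \<gamma>)"
proof -
  note p' = row_mult_stationary[OF p]
  have fin: "(\<Sum>x\<in>F. p x * v x) \<le> b / (1 - \<gamma>)" if F: "finite F" for F
  proof -
    \<comment> \<open>K is at least v + b on F, so there both cutoffs are inactive:
      \<open>w = v\<close> and \<open>u = \<gamma> v + b\<close>.\<close>
    define K where "K = (\<Sum>x\<in>F. v x) + b"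
    define w where "w x = min (v x) K" for x
    define u where "u x = min (\<gamma> * v x + b) K" for x
    have K: "0 \<le> K" using b v by (simp add: K_def sum_nonneg)
    have w: "0 \<le> w x" "w x \<le> K" for x using v[of x] K by (auto simp: w_def)
    have u: "0 \<le> u x" "u x \<le> K" for x using v[of x] \<gamma> K b by (auto simp: u_def)
    have Pw: "(\<Sum>\<^sub>\<infinity>y. P x y * w y) \<le> u x" for x
    proof -
      have "(\<Sum>\<^sub>\<infinity>y. P x y * w y) \<le> (\<Sum>\<^sub>\<infinity>y. P x y * v y)"
        by (intro infsum_mono geometric_driftD(1)[OF drift] mult_left_mono
            nonneg_summable_mult_bounded[OF stochastic_nonneg_summable[OF P] w] stochastic_nonneg[OF P])
          (simp add: w_def)
      also have "\<dots> \<le> \<gamma> * v x + b"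
        using geometric_driftD(2)[OF drift, of x] b by (auto simp: one_level0_def split: if_splits)
      finally show ?thesis
        using stochastic_pairing_bounded(2)[OF P w] by (simp add: u_def)
    qed
    note sw = nonneg_summable_mult_bounded[OF p'(2) w]
    note su = nonneg_summable_mult_bounded[OF p'(2) u]
    \<comment> \<open>Stationarity, usable because w is bounded even though the v-sum is not yet
      known to be finite.\<close>
    have "(\<Sum>\<^sub>\<infinity>x. p x * w x) = (\<Sum>\<^sub>\<infinity>x. p x * (\<Sum>\<^sub>\<infinity>y. P x y * w y))"
      using row_mult_pairing_bounded[OF P p'(2) w] by (simp add: p'(1))
    also have "\<dots> \<le> (\<Sum>\<^sub>\<infinity>x. p x * u x)"
      by (intro infsum_mono su mult_left_mono Pw nonneg_summableD[OF p'(2)]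
          nonneg_summable_mult_bounded[OF p'(2) stochastic_pairing_bounded[OF P w]])
    finally have wu: "(\<Sum>\<^sub>\<infinity>x. p x * w x) \<le> (\<Sum>\<^sub>\<infinity>x. p x * u x)" .
    \<comment> \<open>The summands p(w + b - u) are nonnegative with total at most b, so their
      partial sum over F is at most b; on F they equal (1 - \<gamma>)pv.\<close>
    have "((\<lambda>x. (p x * w x + p x * b) + - (p x * u x)) has_sum
        ((\<Sum>\<^sub>\<infinity>x. p x * w x) + 1 * b) + - (\<Sum>\<^sub>\<infinity>x. p x * u x)) UNIV"
      using p sw su
      by (intro has_sum_add has_sum_uminusI has_sum_cmult_left has_sum_infsum)
        (auto simp: stationary_probability_def)
    moreover have "0 \<le> (p x * w x + p x * b) + - (p x * u x)" for x
    proof -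
      have "\<gamma> * v x \<le> v x" using \<gamma> v[of x] by (simp add: mult_left_le_one_le)
      then have "u x \<le> w x + b" using b by (auto simp: u_def w_def)
      then have "p x * u x \<le> p x * (w x + b)"
        by (intro mult_left_mono nonneg_summableD[OF p'(2)])
      then show ?thesis by (simp add: algebra_simps)
    qed
    ultimately have "(\<Sum>x\<in>F. (p x * w x + p x * b) + - (p x * u x))
        \<le> ((\<Sum>\<^sub>\<infinity>x. p x * w x) + 1 * b) + - (\<Sum>\<^sub>\<infinity>x. p x * u x)"
      using F by (intro finite_sum_le_has_sum) auto
    also have "\<dots> \<le> b" using wu by simp
    also have "(\<Sum>x\<in>F. (p x * w x + p x * b) + - (p x * u x)) = (\<Sum>x\<in>F. (1 - \<gamma>) * (p x * v x))"
    proof (rule sum.cong)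
      fix x assume "x \<in> F"
      then have "v x + b \<le> K" using F v by (simp add: K_def member_le_sum)
      moreover have "\<gamma> * v x \<le> v x" using \<gamma> v[of x] by (simp add: mult_left_le_one_le)
      ultimately have "w x = v x" "u x = \<gamma> * v x + b" using b by (auto simp: w_def u_def)
      then show "(p x * w x + p x * b) + - (p x * u x) = (1 - \<gamma>) * (p x * v x)"
        by (simp add: algebra_simps)
    qed simp
    finally show ?thesis
      using \<gamma> by (simp add: pos_le_divide_eq mult.commute flip: sum_distrib_left)
  qed
  show s: "(\<lambda>x. p x * v x) summable_on UNIV"
  proof (rule nonneg_bdd_above_summable_on)
    show "bdd_above (sum (\<lambda>x. p x * v x) ` {F. F \<subseteq> UNIV \<and> finite F})"
      using fin by (auto intro!: bdd_aboveI2)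
  qed (simp add: v nonneg_summableD[OF p'(2)])
  show "(\<Sum>\<^sub>\<infinity>x. p x * v x) \<le> b / (1 - \<gamma>)"
    by (rule infsum_le_finite_sums[OF s fin])
qed

section \<open>The truncated matrix\<close>

definition cap :: "nat \<Rightarrow> nat \<times> 'd \<Rightarrow> nat \<times> 'd" where
  "cap n x = (min (fst x) n, snd x)"

text \<open>The deterministic kernel of the map \<open>cap n\<close>. The truncation is P followed
  by this kernel, so its properties reduce to those of a product with
  \<open>cap_matrix n\<close>.\<close>

definition cap_matrix :: "nat \<Rightarrow> nat \<times> 'd \<Rightarrow> nat \<times> 'd \<Rightarrow> real" where
  "cap_matrix n x y = of_bool (y = cap n x)"

lemma cap_matrix_pairing:
  fixes f :: "nat \<times> 'd \<Rightarrow> real"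
  shows "((\<lambda>y. cap_matrix n x y * f y) has_sum f (cap n x)) UNIV"
  by (rule has_sum_finite_neutralI[where B = "{cap n x}"]) (auto simp: cap_matrix_def)

lemma stochastic_cap_matrix: "stochastic (cap_matrix n)"
  unfolding stochastic_def using cap_matrix_pairing[of n _ "\<lambda>_. 1"]
  by (intro conjI allI) (simp add: cap_matrix_def, simp only: mult_1_right)

text \<open>The preimage of y under \<open>cap n\<close> is y alone below level n, all levels from n
  on in the phase of y at level n, and empty above; these are the three cases of the
  truncation.\<close>

lemma last_column_truncation_eq_row_mult:
  fixes P :: "nat \<times> 'd::finite \<Rightarrow> nat \<times> 'd \<Rightarrow> real"
  shows "last_column_truncation n P x = row_mult (cap_matrix n) (P x)"
proof
  fix y :: "nat \<times> 'd"
  consider "fst y < n" | "fst y = n" | "fst y > n" by linarith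
  then show "last_column_truncation n P x y = row_mult (cap_matrix n) (P x) y"
  proof cases
    case 1
    then have "row_mult (cap_matrix n) (P x) y = infsum (P x) {y}"
      unfolding row_mult_def
      by (intro infsum_cong_neutral) (auto simp: cap_matrix_def cap_def min_def split: if_splits)
    with 1 show ?thesis by (simp add: last_column_truncation_def)
  next
    case 2
    then have "row_mult (cap_matrix n) (P x) y = (\<Sum>\<^sub>\<infinity>z. P x z * at_least n (snd y) z)"
      unfolding row_mult_def
      by (intro infsum_cong) (auto simp: cap_matrix_def at_least_def cap_def prod_eq_iff min_def)
    with 2 show ?thesis
      by (simp add: last_column_truncation_def tail_eq_pairing[symmetric] tail_def)
  next
    case 3
    then have "cap_matrix n z y = 0" for z
      by (auto simp: cap_matrix_def cap_def)
    with 3 show ?thesis by (simp add: last_column_truncation_def row_mult_def)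
  qed
qed

lemma row_mult_truncation:
  fixes P :: "nat \<times> 'd::finite \<Rightarrow> nat \<times> 'd \<Rightarrow> real"
  assumes "stochastic P" "nonneg_summable \<mu>"
  shows "row_mult (last_column_truncation n P) \<mu> = row_mult (cap_matrix n) (row_mult P \<mu>)"
proof
  fix y
  have "row_mult (cap_matrix n) (row_mult P \<mu>) y = (\<Sum>\<^sub>\<infinity>x. \<mu> x * (\<Sum>\<^sub>\<infinity>z. P x z * cap_matrix n z y))"
    unfolding row_mult_def[of "cap_matrix n"]
    by (rule row_mult_pairing_bounded[OF assms, of _ 1]) (auto simp: cap_matrix_def)
  then show "row_mult (last_column_truncation n P) \<mu> y = row_mult (cap_matrix n) (row_mult P \<mu>) y"
    by (simp add: row_mult_def[of "last_column_truncation n P"] last_column_truncation_eq_row_mult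
      row_mult_def[of "cap_matrix n" "P _"])
qed

text \<open>For l at most n, capping at n does not change whether a level reaches l; for larger l no
  capped level does.\<close>

lemma tail_row_mult_cap:
  assumes "nonneg_summable \<mu>"
  shows "tail (row_mult (cap_matrix n) \<mu>) l j = (if l \<le> n then tail \<mu> l j else 0)"
proof -
  have "tail (cap_matrix n x) l j = at_least l j (cap n x)" for x
    unfolding tail_eq_pairing by (rule infsumI[OF cap_matrix_pairing])
  moreover have "at_least l j (cap n x) = (if l \<le> n then at_least l j x else 0)" for x
    by (auto simp: at_least_def cap_def)
  ultimately show ?thesis
    by (simp add: tail_row_mult[OF stochastic_cap_matrix assms] tail_eq_pairing[of \<mu>])
qed

lemma tail_truncation:
  fixes P :: "nat \<times> 'd::finite \<Rightarrow> nat \<times> 'd \<Rightarrow> real"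
  assumes "stochastic P"
  shows "tail (last_column_truncation n P x) l j = (if l \<le> n then tail (P x) l j else 0)"
  by (simp add: last_column_truncation_eq_row_mult tail_row_mult_cap stochastic_nonneg_summable[OF assms])

lemma stochastic_truncation:
  fixes P :: "nat \<times> 'd::finite \<Rightarrow> nat \<times> 'd \<Rightarrow> real"
  assumes "stochastic P"
  shows "stochastic (last_column_truncation n P)"
proof -
  have ns: "nonneg_summable (last_column_truncation n P x)" for x
    unfolding last_column_truncation_eq_row_mult
    by (intro nonneg_summable_row_mult stochastic_cap_matrix stochastic_nonneg_summable assms)
  \<comment> \<open>The total mass is the sum of the tails at level 0, which the truncation
    preserves.\<close>
  have "infsum (last_column_truncation n P x) UNIV = infsum (P x) UNIV" for x
    using ns[of x] stochastic_nonneg_summable[OF assms, of x]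
    by (simp add: nonneg_summable_def infsum_eq_sum_tail tail_truncation[OF assms])
  then show ?thesis
    using ns assms unfolding stochastic_def nonneg_summable_def has_sum_iff by presburger
qed

lemma block_monotone_truncation:
  fixes P :: "nat \<times> 'd::finite \<Rightarrow> nat \<times> 'd \<Rightarrow> real"
  assumes "block_monotone P"
  shows "block_monotone (last_column_truncation n P)"
  using block_monotoneD[OF assms]
  by (simp add: block_monotone_def tail_def[symmetric] stochastic_truncation tail_truncation)

text \<open>Capping only lowers levels and v is nondecreasing in the level, so the truncated matrix
  applied to v is at most Pv.\<close>

lemma geometric_drift_truncation:
  fixes P :: "nat \<times> 'd::finite \<Rightarrow> nat \<times> 'd \<Rightarrow> real"
  assumes P: "stochastic P" and drift: "geometric_drift P v \<gamma> b"
    and v: "\<And>x. 0 \<le> v x" "\<And>k i. v (k, i) \<le> v (Suc k, i)"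
  shows "geometric_drift (last_column_truncation n P) v \<gamma> b"
  unfolding geometric_drift_def
proof
  fix x
  have le: "P x y * v (cap n y) \<le> P x y * v y" for y
  proof (intro mult_left_mono stochastic_nonneg[OF P])
    show "v (cap n y) \<le> v y"
      using lift_Suc_mono_le[of "\<lambda>k. v (k, snd y)" "min (fst y) n" "fst y"] v(2)
      by (simp add: cap_def)
  qed
  have eq: "(\<Sum>\<^sub>\<infinity>z. cap_matrix n y z * v z) = v (cap n y)" for y
    by (rule infsumI[OF cap_matrix_pairing])
  have s: "(\<lambda>y. P x y * v (cap n y)) summable_on UNIV"
    by (rule summable_on_comparison_test[OF geometric_driftD(1)[OF drift] le]) (simp add: stochastic_nonneg[OF P] v)
  note pairing = row_mult_pairing[where f = v, OF stochastic_cap_matrix[of n]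
      stochastic_nonneg_summable[OF P, of x] v(1) has_sum_imp_summable[OF cap_matrix_pairing],
      unfolded eq, OF s]
  have "(\<Sum>\<^sub>\<infinity>y. last_column_truncation n P x y * v y) \<le> (\<Sum>\<^sub>\<infinity>y. P x y * v y)"
    unfolding last_column_truncation_eq_row_mult pairing(2)
    by (rule infsum_mono[OF s geometric_driftD(1)[OF drift] le])
  also have "\<dots> \<le> \<gamma> * v x + b * one_level0 x"
    by (rule geometric_driftD(2)[OF drift])
  finally show "(\<lambda>y. last_column_truncation n P x y * v y) summable_on UNIV \<and>
      (\<Sum>\<^sub>\<infinity>y. last_column_truncation n P x y * v y) \<le> \<gamma> * v x + b * one_level0 x"
    using pairing(1) by (simp add: last_column_truncation_eq_row_mult)
qed

section \<open>The error of one truncated step\<close>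

lemma nonneg_summable_from_level:
  fixes \<mu> :: "nat \<times> 'd::finite \<Rightarrow> real" and n :: nat
  assumes "nonneg_summable \<mu>"
  defines "\<rho> \<equiv> \<lambda>x. if fst x < n then 0 else \<mu> x"
  shows "nonneg_summable \<rho>" "infsum \<rho> UNIV = (\<Sum>j\<in>UNIV. tail \<mu> n j)"
proof -
  show \<rho>: "nonneg_summable \<rho>"
    using nonneg_summableD[OF assms(1)] summable_on_comparison_test[of \<mu> UNIV \<rho>] assms(1)
    by (auto simp: nonneg_summable_def \<rho>_def)
  have "tail \<rho> 0 j = tail \<mu> n j" for j
    unfolding tail_def by (rule infsum_cong_neutral) (auto simp: \<rho>_def)
  then show "infsum \<rho> UNIV = (\<Sum>j\<in>UNIV. tail \<mu> n j)"
    using \<rho> by (simp add: nonneg_summable_def infsum_eq_sum_tail)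
qed

lemma cap_matrix_below:
  fixes \<mu> :: "nat \<times> 'd::finite \<Rightarrow> real"
  assumes "fst y < n"
  shows "row_mult (cap_matrix n) \<mu> y = \<mu> y"
  \<comment> \<open>Any vector \<mu> is a row of the matrix all of whose rows are \<mu>, so the
    entry can be read off the definition of the truncation.\<close>
  using last_column_truncation_eq_row_mult[of n "\<lambda>_. \<mu>"] assms
  by (metis last_column_truncation_def)

text \<open>The two vectors agree below level n, and from level n on both have the mass given by the
  tails of \<mu>.\<close>

lemma row_norm_cap_diff:
  fixes \<mu> :: "nat \<times> 'd::finite \<Rightarrow> real"
  assumes "nonneg_summable \<mu>"
  shows "row_norm (\<lambda>x. row_mult (cap_matrix n) \<mu> x - \<mu> x) \<le> 2 * (\<Sum>j\<in>UNIV. tail \<mu> n j)"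
proof -
  let ?\<nu> = "row_mult (cap_matrix n) \<mu>"
  note \<nu> = nonneg_summable_row_mult[OF stochastic_cap_matrix assms, of n]
  note upper = nonneg_summable_from_level[OF assms, of n] nonneg_summable_from_level[OF \<nu>, of n]
  have "(\<lambda>x. ?\<nu> x - \<mu> x) =
      (\<lambda>x. (if fst x < n then 0 else ?\<nu> x) - (if fst x < n then 0 else \<mu> x))"
    by (auto simp: cap_matrix_below)
  then show ?thesis
    using nonneg_summable_diff(2)[OF upper(3) upper(1)] upper(2,4) assms
    by (simp add: tail_row_mult_cap)
qed

text \<open>
  Row vectors evolved by the truncation stay dominated by its stationary vector, so the mass that
  one step moves down to level \<open>n\<close> is at most the stationary mass of that level.
\<close>

lemma truncation_error:
  fixes P :: "nat \<times> 'd::finite \<Rightarrow> nat \<times> 'd \<Rightarrow> real"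
  assumes BM: "block_monotone P" and q: "stationary_probability (last_column_truncation n P) q"
    and dom: "dominates q \<delta>"
  shows "row_norm (\<lambda>x. (row_mult (last_column_truncation n P) ^^ t) \<delta> x - (row_mult P ^^ t) \<delta> x)
    \<le> 2 * real t * (\<Sum>j\<in>UNIV. q (n, j))"
proof (induction t)
  case 0
  show ?case by (simp add: row_norm_def)
next
  case (Suc t)
  let ?Q = "last_column_truncation n P"
  let ?\<mu> = "(row_mult ?Q ^^ t) \<delta>" and ?\<nu> = "(row_mult P ^^ t) \<delta>"
  note P = block_monotoneD(1)[OF BM]
  note Q = stochastic_truncation[OF P, of n]
  note q' = row_mult_stationary[OF q]
  have \<delta>: "nonneg_summable \<delta>" using dom by (simp add: dominates_def)
  note \<mu> = funpow_row_mult[OF Q \<delta>, of t] and \<nu> = funpow_row_mult[OF P \<delta>, of t]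
  have "(row_mult ?Q ^^ t) q = q" for t
    by (induction t) (simp_all add: q'(1))
  then have domt: "dominates q ((row_mult ?Q ^^ Suc t) \<delta>)"
    using dominates_funpow_row_mult[OF block_monotone_truncation[OF BM] dom, where t = "Suc t"] by metis
  \<comment> \<open>As the image of a capped step, q lives on levels up to n, so its tail from n is
    the single entry at n.\<close>
  have "q = row_mult (cap_matrix n) (row_mult P q)"
    using row_mult_truncation[OF P q'(2), of n] q'(1) by simp
  moreover from this have "q (n, j) = tail (row_mult P q) n j" for j
    using last_column_truncation_eq_row_mult[of n "\<lambda>_. row_mult P q"]
    by (metis fst_conv snd_conv last_column_truncation_def less_irrefl tail_def)
  ultimately have tail_q: "tail q n j = q (n, j)" for j
    using tail_row_mult_cap[OF nonneg_summable_row_mult[OF P q'(2)], of n n j] by simp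
  have "row_norm (\<lambda>x. row_mult ?Q ?\<mu> x - row_mult P ?\<mu> x) \<le> 2 * (\<Sum>j\<in>UNIV. tail (row_mult P ?\<mu>) n j)"
    unfolding row_mult_truncation[OF P \<mu>]
    by (rule row_norm_cap_diff[OF nonneg_summable_row_mult[OF P \<mu>]])
  \<comment> \<open>Capping at n preserves the tail at n, so the moved mass can be measured after
    the truncated step, where q dominates.\<close>
  also have "\<dots> = 2 * (\<Sum>j\<in>UNIV. tail (row_mult ?Q ?\<mu>) n j)"
    by (simp add: row_mult_truncation[OF P \<mu>] tail_row_mult_cap nonneg_summable_row_mult[OF P \<mu>])
  also have "\<dots> \<le> 2 * (\<Sum>j\<in>UNIV. q (n, j))"
    using domt by (intro mult_left_mono sum_mono) (simp_all add: dominates_def flip: tail_q)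
  finally have one: "row_norm (\<lambda>x. row_mult ?Q ?\<mu> x - row_mult P ?\<mu> x) \<le> 2 * (\<Sum>j\<in>UNIV. q (n, j))" .
  \<comment> \<open>The error accumulated so far is not enlarged by a further multiplication by
    P.\<close>
  have rest: "row_norm (\<lambda>x. row_mult P ?\<mu> x - row_mult P ?\<nu> x) \<le> 2 * real t * (\<Sum>j\<in>UNIV. q (n, j))"
    using row_norm_row_mult_le[OF P nonneg_summable_diff(1)[OF \<mu> \<nu>]] Suc.IH
    by (simp add: row_mult_diff[OF P \<mu> \<nu>])
  have "row_norm (\<lambda>x. row_mult ?Q ?\<mu> x - row_mult P ?\<nu> x)
     \<le> row_norm (\<lambda>x. row_mult ?Q ?\<mu> x - row_mult P ?\<mu> x) + row_norm (\<lambda>x. row_mult P ?\<mu> x - row_mult P ?\<nu> x)"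
    by (intro row_norm_diff_triangle nonneg_summable_row_mult P Q \<mu> \<nu>)
  with one rest show ?case by (simp add: algebra_simps)
qed

section \<open>Phase marginals and the error bound\<close>

text \<open>The hypothesis \<open>spread\<close> stands for irreducibility of \<Psi>. It is applied
  to twice the positive part of the difference h = f - g: if this were nonzero, h would be positive
  everywhere, against its zero sum.\<close>

lemma invariant_vector_unique:
  fixes \<Psi> :: "'d::finite \<Rightarrow> 'd \<Rightarrow> real"
  assumes \<Psi>: "\<And>i j. 0 \<le> \<Psi> i j" "\<And>i. (\<Sum>j\<in>UNIV. \<Psi> i j) = 1"
    and spread: "\<And>u i j. (\<And>i. 0 \<le> u i) \<Longrightarrow> (\<And>j. u j = (\<Sum>i\<in>UNIV. u i * \<Psi> i j)) \<Longrightarrow> 0 < u i \<Longrightarrow> 0 < u j"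
    and f: "\<And>j. f j = (\<Sum>i\<in>UNIV. f i * \<Psi> i j)" and g: "\<And>j. g j = (\<Sum>i\<in>UNIV. g i * \<Psi> i j)"
    and total: "sum f UNIV = sum g UNIV"
  shows "f j = g j"
proof -
  define h where "h i = f i - g i" for i
  have h: "h j = (\<Sum>i\<in>UNIV. h i * \<Psi> i j)" for j
    using f[of j] g[of j] by (simp add: h_def left_diff_distrib sum_subtractf)
  have h_total: "sum h UNIV = 0"
    using total by (simp add: h_def sum_subtractf)
  have abs_le: "\<bar>h j\<bar> \<le> (\<Sum>i\<in>UNIV. \<bar>h i\<bar> * \<Psi> i j)" for j
    using sum_abs[of "\<lambda>i. h i * \<Psi> i j" UNIV] h[of j] \<Psi>(1) by (simp add: abs_mult)
  \<comment> \<open>Row sums equal to 1 make both sides of \<open>abs_le\<close> have the same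
    total, so every one of these inequalities is an equality.\<close>
  have "(\<Sum>j\<in>UNIV. \<Sum>i\<in>UNIV. \<bar>h i\<bar> * \<Psi> i j) = (\<Sum>j\<in>UNIV. \<bar>h j\<bar>)"
    by (subst sum.swap) (simp add: \<Psi>(2) flip: sum_distrib_left)
  then have "(\<Sum>j\<in>UNIV. (\<Sum>i\<in>UNIV. \<bar>h i\<bar> * \<Psi> i j) - \<bar>h j\<bar>) = 0"
    by (simp add: sum_subtractf)
  then have abs: "\<bar>h j\<bar> = (\<Sum>i\<in>UNIV. \<bar>h i\<bar> * \<Psi> i j)" for j
    using abs_le by (subst (asm) sum_nonneg_eq_0_iff) auto
  have "h i \<le> 0" for i
  proof (rule ccontr)
    assume i: "\<not> h i \<le> 0"
    have "0 < \<bar>h j\<bar> + h j" for j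
    proof (rule spread[where i = i])
      show "\<bar>h j\<bar> + h j = (\<Sum>i\<in>UNIV. (\<bar>h i\<bar> + h i) * \<Psi> i j)" for j
        using abs[of j] h[of j] by (simp add: distrib_right sum.distrib)
    qed (use i in auto)
    then have "0 < h j" for j
      by (smt (verit))
    then have "0 < sum h UNIV" by (intro sum_pos) auto
    with h_total show False by simp
  qed
  moreover from this have "h j = 0"
    using h_total sum_nonneg_eq_0_iff[of UNIV "\<lambda>i. - h i"] by (simp add: sum_negf)
  ultimately show ?thesis by (simp add: h_def)
qed

lemma mat_power_nonneg: "stochastic P \<Longrightarrow> 0 \<le> mat_power P t x y"
  by (induction t arbitrary: x) (auto intro!: infsum_nonneg simp: stochastic_nonneg)

text \<open>A path of positive probability under P projects to phases with positive transition
  probabilities, and an invariant u carries positivity along it. This passes irreducibility from P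
  to the phase kernel.\<close>

lemma mat_power_spread:
  fixes P :: "nat \<times> 'd::finite \<Rightarrow> nat \<times> 'd \<Rightarrow> real"
  assumes BM: "block_monotone P" and u: "\<And>i. 0 \<le> u i" "\<And>j. u j = (\<Sum>i\<in>UNIV. u i * tail (P (0, i)) 0 j)"
    and "0 < mat_power P t x y" "0 < u (snd x)"
  shows "0 < u (snd y)"
  using assms(4,5)
proof (induction t arbitrary: x)
  case 0
  then show ?case by (auto split: if_splits)
next
  case (Suc t)
  note P = block_monotoneD(1)[OF BM]
  have "\<exists>z. 0 < P x z * mat_power P t z y"
  proof (rule ccontr)
    assume "\<nexists>z. 0 < P x z * mat_power P t z y"
    then have "P x z * mat_power P t z y = 0" for z
      by (intro antisym mult_nonneg_nonneg stochastic_nonneg[OF P] mat_power_nonneg[OF P])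
        (use not_less in blast)
    with Suc.prems(1) show False by simp
  qed
  then obtain z where "0 < P x z * mat_power P t z y" ..
  then have z: "0 < P x z" "0 < mat_power P t z y"
    using stochastic_nonneg[OF P, of x z] by (auto simp: zero_less_mult_iff)
  have "P x z \<le> tail (P x) 0 (snd z)"
    using stochastic_nonneg_summable[OF P, of x]
      finite_sum_le_infsum[of "\<lambda>m. P x (m, snd z)" "{0..}" "{fst z}"] summable_on_phase[of "P x" "snd z"]
    by (auto simp: tail_def nonneg_summable_def)
  also have "\<dots> = tail (P (0, snd x)) 0 (snd z)"
    using phase_kernel_const[OF BM, of "fst x" "snd x"] by simp
  finally have "0 < u (snd x) * tail (P (0, snd x)) 0 (snd z)"
    using z(1) Suc.prems(2) by simp
  also have "\<dots> \<le> u (snd z)"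
    unfolding u(2)[of "snd z"] by (rule member_le_sum) (auto simp: u(1) tail_stochastic[OF P])
  finally show ?case by (rule Suc.IH[OF z(2)])
qed

text \<open>Truncation leaves the tails of the rows at level 0 unchanged, so both marginals are
  invariant under one phase kernel, with total 1.\<close>

lemma phase_marginals_eq:
  fixes P :: "nat \<times> 'd::finite \<Rightarrow> nat \<times> 'd \<Rightarrow> real"
  assumes BM: "block_monotone P" and irr: "irreducible_matrix P"
    and p: "stationary_probability P p" and q: "stationary_probability (last_column_truncation n P) q"
  shows "tail p 0 j = tail q 0 j"
proof (rule invariant_vector_unique[where \<Psi> = "\<lambda>i j. tail (P (0, i)) 0 j"])
  note P = block_monotoneD(1)[OF BM]
  note p' = row_mult_stationary[OF p] and q' = row_mult_stationary[OF q]
  show "0 \<le> tail (P (0, i)) 0 j" for i j by (rule tail_stochastic[OF P])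
  show "(\<Sum>j\<in>UNIV. tail (P (0, i)) 0 j) = 1" for i
    using infsum_eq_sum_tail[of "P (0, i)"] stochastic_has_sum[OF P, of "(0, i)"]
    by (simp add: has_sum_iff)
  show "0 < u j" if "\<And>i. 0 \<le> u i" "\<And>j. u j = (\<Sum>i\<in>UNIV. u i * tail (P (0, i)) 0 j)" "0 < u i"
    for u and i j :: 'd
  proof -
    obtain t where "0 < mat_power P t (0, i) (0, j)"
      using irr unfolding irreducible_matrix_def by blast
    from mat_power_spread[OF BM that(1,2) this] show ?thesis using that(3) by simp
  qed
  show "tail p 0 j = (\<Sum>i\<in>UNIV. tail p 0 i * tail (P (0, i)) 0 j)" for j
    by (rule phase_marginal_row_mult[OF BM p'(2), unfolded p'(1)])
  show "tail q 0 j = (\<Sum>i\<in>UNIV. tail q 0 i * tail (P (0, i)) 0 j)" for j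
    using phase_marginal_row_mult[OF block_monotone_truncation[OF BM, of n] q'(2), where j = j]
    by (simp only: q'(1) tail_truncation[OF P] le0 if_True)
  show "(\<Sum>j\<in>UNIV. tail p 0 j) = (\<Sum>j\<in>UNIV. tail q 0 j)"
    using p'(2,3) q'(2,3) by (simp add: nonneg_summable_def infsum_eq_sum_tail)
qed

section \<open>Assembling the error bound\<close>

lemma dominates_cap0:
  assumes "nonneg_summable \<mu>" "nonneg_summable \<nu>" "\<And>j. tail \<nu> 0 j = tail \<mu> 0 j"
  shows "dominates \<mu> (row_mult (cap_matrix 0) \<nu>)"
  using assms
  by (simp add: dominates_def tail_row_mult_cap nonneg_summable_row_mult stochastic_cap_matrix tail_nonneg)

text \<open>Since p is fixed by P, the difference is the t-step image of
  \<open>p - \<delta>\<close>; contraction applies, and the stationary mean of v is at most b/(1 -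
  \<gamma>).\<close>

lemma stationary_distance:
  fixes P :: "nat \<times> 'd::finite \<Rightarrow> nat \<times> 'd \<Rightarrow> real"
  assumes BM: "block_monotone P" and drift: "geometric_drift P v \<gamma> b" and v: "\<And>x. 1 \<le> v x"
    and \<gamma>: "0 \<le> \<gamma>" "\<gamma> < 1" and b: "0 \<le> b"
    and p: "stationary_probability P p" and dom: "dominates p \<delta>"
  shows "row_norm (\<lambda>x. p x - (row_mult P ^^ t) \<delta> x) \<le> 2 * \<gamma> ^ t * (b / (1 - \<gamma>))"
proof -
  note P = block_monotoneD(1)[OF BM]
  note p' = row_mult_stationary[OF p]
  have v0: "0 \<le> v x" for x using v[of x] by simp
  note bound = stationary_drift_bound[OF P drift v0 \<gamma> b p]
  have \<delta>: "nonneg_summable \<delta>" using dom by (simp add: dominates_def)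
  have "(row_mult P ^^ t) p = p" by (induction t) (simp_all add: p'(1))
  then have "row_norm (\<lambda>x. p x - (row_mult P ^^ t) \<delta> x) = row_norm ((row_mult P ^^ t) (\<lambda>x. p x - \<delta> x))"
    by (simp add: funpow_row_mult_diff[OF P p'(2) \<delta>])
  also have "\<dots> \<le> 2 * \<gamma> ^ t * (\<Sum>\<^sub>\<infinity>x. p x * v x)"
    by (rule dominated_diff_contraction[OF BM drift v \<gamma>(1) dom bound(1)])
  also have "\<dots> \<le> 2 * \<gamma> ^ t * (b / (1 - \<gamma>))"
    using \<gamma>(1) by (intro mult_left_mono bound(2)) simp
  finally show ?thesis .
qed

theorem theorem3p1:
  fixes P :: "nat \<times> 'd::finite \<Rightarrow> nat \<times> 'd \<Rightarrow> real"
    and \<pi> \<pi>\<^sub>n v :: "nat \<times> 'd \<Rightarrow> real"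
    and \<gamma> b :: real
    and n m :: nat
  assumes "stochastic P"
    and "irreducible_matrix P"
    and "positive_recurrent P"
    and "block_monotone P"
    and "stationary_probability P \<pi>"
    and "\<And>k i. 1 \<le> v (k, i)"
    and "\<And>k i. v (k, i) \<le> v (k + 1, i)"
    and "0 < \<gamma>" and "\<gamma> < 1" and "0 < b"
    and "geometric_drift P v \<gamma> b"
    and "1 \<le> n" and "1 \<le> m"
    and "stationary_probability (last_column_truncation n P) \<pi>\<^sub>n"
  shows "row_norm (\<lambda>x. \<pi>\<^sub>n x - \<pi> x)
           \<le> 4 * \<gamma> ^ m * (b / (1 - \<gamma>)) + 2 * real m * (\<Sum>i\<in>UNIV. \<pi>\<^sub>n (n, i)) \<and>
         row_norm (\<lambda>x. \<pi>\<^sub>n x - \<pi> x)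
           \<le> b / (1 - \<gamma>) * (4 * \<gamma> ^ m + 2 * real m * (\<Sum>i\<in>UNIV. 1 / v (n, i)))"
proof -
  let ?Q = "last_column_truncation n P"
  note P = assms(1) and BM = assms(4) and p = assms(5) and drift = assms(11) and q = assms(14)
  note Q = stochastic_truncation[OF P, of n] and BM_Q = block_monotone_truncation[OF BM, of n]
  note p' = row_mult_stationary[OF p] and q' = row_mult_stationary[OF q]
  have v: "1 \<le> v x" for x using assms(6)[of "fst x" "snd x"] by simp
  then have v0: "0 \<le> v x" for x by (meson order_trans zero_le_one)
  have \<gamma>: "0 \<le> \<gamma>" "\<gamma> < 1" and b: "0 \<le> b" using assms(8-10) by auto
  have drift_Q: "geometric_drift ?Q v \<gamma> b"
    by (rule geometric_drift_truncation[OF P drift v0]) (use assms(7) in simp)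

  \<comment> \<open>All mass of \<pi> is moved to level 0 within its phase, so the tails of \<delta>
    above level 0 vanish. As \<pi> and \<open>\<pi>\<^sub>n\<close> share the phase marginal,
    \<delta> lies below both.\<close>
  define \<delta> where "\<delta> = row_mult (cap_matrix 0) \<pi>"
  have dom_p: "dominates \<pi> \<delta>" and dom_q: "dominates \<pi>\<^sub>n \<delta>"
    unfolding \<delta>_def
    by (intro dominates_cap0 p' q' refl phase_marginals_eq[OF BM assms(2) p q])+
  then have \<delta>: "nonneg_summable \<delta>" by (simp add: dominates_def)
  let ?\<mu> = "(row_mult ?Q ^^ m) \<delta>" and ?\<nu> = "(row_mult P ^^ m) \<delta>"
  note \<mu> = funpow_row_mult[OF Q \<delta>, of m] and \<nu> = funpow_row_mult[OF P \<delta>, of m]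

  have "row_norm (\<lambda>x. \<pi>\<^sub>n x - \<pi> x)
      \<le> row_norm (\<lambda>x. \<pi>\<^sub>n x - ?\<mu> x) + row_norm (\<lambda>x. ?\<mu> x - \<pi> x)"
    by (rule row_norm_diff_triangle[OF q'(2) \<mu> p'(2)])
  also have "\<dots> \<le> row_norm (\<lambda>x. \<pi>\<^sub>n x - ?\<mu> x)
      + (row_norm (\<lambda>x. ?\<mu> x - ?\<nu> x) + row_norm (\<lambda>x. ?\<nu> x - \<pi> x))"
    by (intro add_left_mono row_norm_diff_triangle[OF \<mu> \<nu> p'(2)])
  also have "\<dots> \<le> 2 * \<gamma> ^ m * (b / (1 - \<gamma>))
      + (2 * real m * (\<Sum>i\<in>UNIV. \<pi>\<^sub>n (n, i)) + 2 * \<gamma> ^ m * (b / (1 - \<gamma>)))"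
  proof (intro add_mono)
    show "row_norm (\<lambda>x. \<pi>\<^sub>n x - ?\<mu> x) \<le> 2 * \<gamma> ^ m * (b / (1 - \<gamma>))"
      by (rule stationary_distance[OF BM_Q drift_Q v \<gamma> b q dom_q])
    show "row_norm (\<lambda>x. ?\<mu> x - ?\<nu> x) \<le> 2 * real m * (\<Sum>i\<in>UNIV. \<pi>\<^sub>n (n, i))"
      by (rule truncation_error[OF BM q dom_q])
    show "row_norm (\<lambda>x. ?\<nu> x - \<pi> x) \<le> 2 * \<gamma> ^ m * (b / (1 - \<gamma>))"
      using stationary_distance[OF BM drift v \<gamma> b p dom_p, of m]
      by (simp add: row_norm_def abs_minus_commute)
  qed
  also have "\<dots> = 4 * \<gamma> ^ m * (b / (1 - \<gamma>)) + 2 * real m * (\<Sum>i\<in>UNIV. \<pi>\<^sub>n (n, i))"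
    by simp
  finally have first: "row_norm (\<lambda>x. \<pi>\<^sub>n x - \<pi> x)
      \<le> 4 * \<gamma> ^ m * (b / (1 - \<gamma>)) + 2 * real m * (\<Sum>i\<in>UNIV. \<pi>\<^sub>n (n, i))" .

  \<comment> \<open>Markov's inequality in each phase: the drift condition, inherited by the
    truncation, bounds the mean of v under \<open>\<pi>\<^sub>n\<close>, hence each mass at level
    n.\<close>
  note bound = stationary_drift_bound[OF Q drift_Q v0 \<gamma> b q]
  have "\<pi>\<^sub>n (n, i) \<le> b / (1 - \<gamma>) * (1 / v (n, i))" for i
  proof -
    have "\<pi>\<^sub>n (n, i) * v (n, i) \<le> (\<Sum>\<^sub>\<infinity>x. \<pi>\<^sub>n x * v x)"
      using finite_sum_le_infsum[OF bound(1), of "{(n, i)}"] v0 nonneg_summableD[OF q'(2)] by simp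
    with bound(2) have "\<pi>\<^sub>n (n, i) * v (n, i) \<le> b / (1 - \<gamma>)" by linarith
    moreover have "0 < v (n, i)" using v[of "(n, i)"] by linarith
    ultimately have "\<pi>\<^sub>n (n, i) \<le> b / (1 - \<gamma>) / v (n, i)"
      by (simp only: pos_le_divide_eq)
    then show ?thesis by (simp only: times_divide_eq_right mult_1_right)
  qed
  then have "(\<Sum>i\<in>UNIV. \<pi>\<^sub>n (n, i)) \<le> b / (1 - \<gamma>) * (\<Sum>i\<in>UNIV. 1 / v (n, i))"
    by (subst sum_distrib_left) (rule sum_mono)
  then have "4 * \<gamma> ^ m * (b / (1 - \<gamma>)) + 2 * real m * (\<Sum>i\<in>UNIV. \<pi>\<^sub>n (n, i))
      \<le> 4 * \<gamma> ^ m * (b / (1 - \<gamma>)) + 2 * real m * (b / (1 - \<gamma>) * (\<Sum>i\<in>UNIV. 1 / v (n, i)))"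
    by (intro add_left_mono mult_left_mono) simp_all
  also have "\<dots>
      = b / (1 - \<gamma>) * (4 * \<gamma> ^ m + 2 * real m * (\<Sum>i\<in>UNIV. 1 / v (n, i)))"
    by (simp only: distrib_left mult_ac)
  finally show ?thesis using first order_trans[OF first] by blast
qed

end
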